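(* Let $\mathcal{A}\in\mathbb{R}^{p\times p}$ be a symmetric positive definite matrix with inverse $\mathcal{H}=\mathcal{A}^{-1}$, and let $\mathcal{I}_1,\mathcal{I}_2$ be (nonempty) index sets with $\mathcal{I}_1\cup\mathcal{I}_2=\{1,2,\ldots,p\}$ and $\mathcal{I}_1\cap\mathcal{I}_2=\emptyset$. Let $\mathcal{H}_{\mathcal{I}_2}$ be the sub-matrix formed from the rows and columns of $\mathcal{H}$ indexed by $\mathcal{I}_2$, and let $\tilde{\mathcal{H}}^{(r,2)}_{\mathcal{I}_2}$ be the approximation of this matrix after $r$ complete iterations of the two-block iterative block matrix inversion (IBMI) algorithm with sets $\mathcal{I}_1$ and $\mathcal{I}_2$, started from the initial guess $\tilde{\mathcal{H}}^{(0,2)}_{\mathcal{I}_2}\in\mathbb{R}^{|\mathcal{I}_2|\times|\mathcal{I}_2|}$. Then $$\left\|\tilde{\mathcal{H}}^{(r,2)}_{\mathcal{I}_2}-\mathcal{H}_{\mathcal{I}_2}\right\|_2\le\left\|\mathcal{A}_{\mathcal{I}_2}^{-1}\mathcal{A}_{\mathcal{I}_2,\mathcal{I}_1}\mathcal{A}_{\mathcal{I}_1}^{-1}\mathcal{A}_{\mathcal{I}_1,\mathcal{I}_2}\right\|_2^{2r}\left\|\tilde{\mathcal{H}}^{(0,2)}_{\mathcal{I}_2}-\mathcal{H}_{\mathcal{I}_2}\right\|_2 .$$ Moreover, the iterative method converges for any symmetric positive definite initial guess $\tilde{\mathcal{H}}^{(0,2)}_{\mathcal{I}_2}$, i.e.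 $\tilde{\mathcal{H}}^{(r,2)}_{\mathcal{I}_2}\to\mathcal{H}_{\mathcal{I}_2}$ as $r\to\infty$.
   Context: Notation: for index sets $\mathcal{I},\mathcal{J}\subseteq\{1,\ldots,p\}$ and a $p\times p$ matrix $M$, $M_{\mathcal{I},\mathcal{J}}$ is the sub-matrix of $M$ with rows indexed by $\mathcal{I}$ and columns indexed by $\mathcal{J}$, and $M_{\mathcal{I}}=M_{\mathcal{I},\mathcal{I}}$. In particular $\mathcal{A}_{\mathcal{I}}^{-1}$ means $(\mathcal{A}_{\mathcal{I}})^{-1}$. $\|\cdot\|_2$ is the matrix norm induced by the Euclidean norm. Superscripts $(r,k)$ on $\tilde{\mathcal{H}}$ are labels (iteration $r$, set $k$), not powers. Two-block IBMI algorithm (non-overlapping case, $\mathcal{I}_1^c=\mathcal{I}_2$, $\mathcal{I}_2^c=\mathcal{I}_1$). Given an initial guess $\tilde{\mathcal{H}}^{(0,2)}_{\mathcal{I}_2}$ for $\mathcal{H}_{\mathcal{I}_2}$, iteration $r=1,2,\ldots$ consists of two steps. Step $k=1$: form the $p\times p$ matrix $\tilde{\mathcal{H}}^{(r,1)}$ whose blocks are $\tilde{\mathcal{H}}^{(r,1)}_{\mathcal{I}_1}=\mathcal{A}_{\mathcal{I}_1}^{-1}+\mathcal{A}_{\mathcal{I}_1}^{-1}\mathcal{A}_{\mathcal{I}_1,\mathcal{I}_2}\tilde{\mathcal{H}}^{(r-1,2)}_{\mathcal{I}_2}\mathcal{A}_{\mathcal{I}_2,\mathcal{I}_1}\mathcal{A}_{\mathcal{I}_1}^{-1}$,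 $\tilde{\mathcal{H}}^{(r,1)}_{\mathcal{I}_1,\mathcal{I}_2}=-\mathcal{A}_{\mathcal{I}_1}^{-1}\mathcal{A}_{\mathcal{I}_1,\mathcal{I}_2}\tilde{\mathcal{H}}^{(r-1,2)}_{\mathcal{I}_2}$, $\tilde{\mathcal{H}}^{(r,1)}_{\mathcal{I}_2,\mathcal{I}_1}=-\tilde{\mathcal{H}}^{(r-1,2)}_{\mathcal{I}_2}\mathcal{A}_{\mathcal{I}_2,\mathcal{I}_1}\mathcal{A}_{\mathcal{I}_1}^{-1}$, $\tilde{\mathcal{H}}^{(r,1)}_{\mathcal{I}_2}=\tilde{\mathcal{H}}^{(r-1,2)}_{\mathcal{I}_2}$. Step $k=2$: form the $p\times p$ matrix $\tilde{\mathcal{H}}^{(r,2)}$ whose blocks are $\tilde{\mathcal{H}}^{(r,2)}_{\mathcal{I}_2}=\mathcal{A}_{\mathcal{I}_2}^{-1}+\mathcal{A}_{\mathcal{I}_2}^{-1}\mathcal{A}_{\mathcal{I}_2,\mathcal{I}_1}\tilde{\mathcal{H}}^{(r,1)}_{\mathcal{I}_1}\mathcal{A}_{\mathcal{I}_1,\mathcal{I}_2}\mathcal{A}_{\mathcal{I}_2}^{-1}$, $\tilde{\mathcal{H}}^{(r,2)}_{\mathcal{I}_2,\mathcal{I}_1}=-\mathcal{A}_{\mathcal{I}_2}^{-1}\mathcal{A}_{\mathcal{I}_2,\mathcal{I}_1}\tilde{\mathcal{H}}^{(r,1)}_{\mathcal{I}_1}$, $\tilde{\mathcal{H}}^{(r,2)}_{\mathcal{I}_1,\mathcal{I}_2}=-\tilde{\mathcal{H}}^{(r,1)}_{\mathcal{I}_1}\mathcal{A}_{\mathcal{I}_1,\mathcal{I}_2}\mathcal{A}_{\mathcal{I}_2}^{-1}$,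 $\tilde{\mathcal{H}}^{(r,2)}_{\mathcal{I}_1}=\tilde{\mathcal{H}}^{(r,1)}_{\mathcal{I}_1}$. The iterates are considered for all $r\ge 1$ (no stopping criterion is applied). *)

theory Defs
  imports
    Complex_Main
    "Jordan_Normal_Form.Gauss_Jordan_Elimination"
    "Jordan_Normal_Form.Determinant"
    "Jordan_Normal_Form.DL_Submatrix"
begin

text \<open>
  Rows and columns are numbered from \<open>0\<close>, so index sets are subsets of \<open>{0..<p}\<close>.
  The sub-matrix of \<open>M\<close> with rows in \<open>I\<close> and columns in \<open>J\<close> is \<^term>\<open>submatrix M I J\<close>,
  which lists the indices of \<open>I\<close> and of \<open>J\<close> in increasing order.
\<close>

definition sym_pos_def :: "real mat \<Rightarrow> bool" where
  "sym_pos_def A \<longleftrightarrow>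
     square_mat A \<and> transpose_mat A = A \<and>
     (\<forall>v \<in> carrier_vec (dim_row A). v \<noteq> 0\<^sub>v (dim_row A) \<longrightarrow> 0 < v \<bullet> (A *\<^sub>v v))"

text \<open>Unspecified when \<open>A\<close> is not invertible.\<close>

definition mat_inv :: "real mat \<Rightarrow> real mat" where
  "mat_inv A = the (mat_inverse A)"

definition vec_norm2 :: "real vec \<Rightarrow> real" where
  "vec_norm2 v = sqrt (v \<bullet> v)"

text \<open>
  The induced norm. The zero vector contributes \<open>0 / 0 = 0\<close>, as in \<open>onorm\<close>, and the
  supremum is over a nonempty bounded set for every matrix.
\<close>

definition mat_norm2 :: "real mat \<Rightarrow> real" where
  "mat_norm2 M = (SUP v \<in> carrier_vec (dim_col M). vec_norm2 (M *\<^sub>v v) / vec_norm2 v)"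

text \<open>
  The \<open>p \<times> p\<close> matrix with prescribed blocks at \<open>I \<times> I\<close>, \<open>I \<times> J\<close>, \<open>J \<times> I\<close>, \<open>J \<times> J\<close>,
  where \<open>I\<close> and \<open>J\<close> partition \<open>{0..<p}\<close>. The position of an index \<open>i\<close> inside a block is the
  number of smaller indices in the same set, which inverts the enumeration \<^const>\<open>pick\<close>
  used by \<^const>\<open>submatrix\<close>.
\<close>

definition assemble_blocks ::
    "nat \<Rightarrow> nat set \<Rightarrow> nat set \<Rightarrow> 'a mat \<Rightarrow> 'a mat \<Rightarrow> 'a mat \<Rightarrow> 'a mat \<Rightarrow> 'a mat" where
  "assemble_blocks p I J B_II B_IJ B_JI B_JJ =
     mat p p (\<lambda>(i, j).
       let pos = (\<lambda>S k. card {a \<in> S. a < k}) in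
       if i \<in> I then (if j \<in> I then B_II $$ (pos I i, pos I j) else B_IJ $$ (pos I i, pos J j))
       else (if j \<in> I then B_JI $$ (pos J i, pos I j) else B_JJ $$ (pos J i, pos J j)))"

text \<open>
  One step of the algorithm: \<open>X\<close> is the current approximation of the \<open>J \<times> J\<close> block of the
  inverse. The first step of an iteration has \<open>I = I\<^sub>1\<close>, \<open>J = I\<^sub>2\<close>, the second has the roles
  exchanged.
\<close>

definition ibmi_step :: "real mat \<Rightarrow> nat set \<Rightarrow> nat set \<Rightarrow> real mat \<Rightarrow> real mat" where
  "ibmi_step A I J X =
     (let A_I_inv = mat_inv (submatrix A I I);
          A_IJ = submatrix A I J;
          A_JI = submatrix A J I
      in assemble_blocks (dim_row A) I J
           (A_I_inv + A_I_inv * A_IJ * X * A_JI * A_I_inv)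
           (- (A_I_inv * A_IJ * X))
           (- (X * A_JI * A_I_inv))
           X)"

text \<open>The \<open>I\<^sub>2 \<times> I\<^sub>2\<close> block of the iterate after \<open>r\<close> complete iterations, with initial guess \<open>G\<close>.\<close>

primrec ibmi_block :: "real mat \<Rightarrow> nat set \<Rightarrow> nat set \<Rightarrow> real mat \<Rightarrow> nat \<Rightarrow> real mat" where
  "ibmi_block A I1 I2 G 0 = G"
| "ibmi_block A I1 I2 G (Suc r) =
     (let H1 = ibmi_step A I1 I2 (ibmi_block A I1 I2 G r);
          H2 = ibmi_step A I2 I1 (submatrix H1 I1 I1)
      in submatrix H2 I2 I2)"

lemma sym_pos_def_mat_inv:
  assumes A: "A \<in> carrier_mat n n" and pd: "sym_pos_def A"
  shows "mat_inv A \<in> carrier_mat n n" "A * mat_inv A = 1\<^sub>m n" "mat_inv A * A = 1\<^sub>m n"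
proof -
  have "det A \<noteq> 0"
  proof
    assume "det A = 0"
    then obtain v where v: "v \<in> carrier_vec n" "v \<noteq> 0\<^sub>v n" "A *\<^sub>v v = 0\<^sub>v n"
      using det_0_iff_vec_prod_zero_field[OF A] by auto
    then show False using pd A unfolding sym_pos_def_def by auto
  qed
  then have "A \<in> Units (ring_mat TYPE(real) n ())" by (rule det_non_zero_imp_unit[OF A])
  then obtain B where "mat_inverse A = Some B"
    using mat_inverse(1)[OF A, where b = "()"] by (cases "mat_inverse A") auto
  with mat_inverse(2)[OF A this]
  show "mat_inv A \<in> carrier_mat n n" "A * mat_inv A = 1\<^sub>m n" "mat_inv A * A = 1\<^sub>m n"
    by (auto simp: mat_inv_def)
qed

lemma submatrix_assemble_blocks:
  assumes part: "I \<union> J = {0..<p}" "I \<inter> J = {}"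
    and carr: "B_II \<in> carrier_mat (card I) (card I)" "B_IJ \<in> carrier_mat (card I) (card J)"
      "B_JI \<in> carrier_mat (card J) (card I)" "B_JJ \<in> carrier_mat (card J) (card J)"
  shows "submatrix (assemble_blocks p I J B_II B_IJ B_JI B_JJ) I I = B_II"
    "submatrix (assemble_blocks p I J B_II B_IJ B_JI B_JJ) I J = B_IJ"
    "submatrix (assemble_blocks p I J B_II B_IJ B_JI B_JJ) J I = B_JI"
    "submatrix (assemble_blocks p I J B_II B_IJ B_JI B_JJ) J J = B_JJ"
proof -
  have sets: "{i. i < p \<and> i \<in> I} = I" "{i. i < p \<and> i \<in> J} = J" using part by auto
  have pI: "pick I i \<in> I" "pick I i \<notin> J" "pick I i < p" "card {a \<in> I. a < pick I i} = i"
    if "i < card I" for i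
    using pick_in_set_le[OF that] card_pick_le[OF that] part by auto
  have pJ: "pick J i \<in> J" "pick J i \<notin> I" "pick J i < p" "card {a \<in> J. a < pick J i} = i"
    if "i < card J" for i
    using pick_in_set_le[OF that] card_pick_le[OF that] part by auto
  show "submatrix (assemble_blocks p I J B_II B_IJ B_JI B_JJ) I I = B_II"
    "submatrix (assemble_blocks p I J B_II B_IJ B_JI B_JJ) I J = B_IJ"
    "submatrix (assemble_blocks p I J B_II B_IJ B_JI B_JJ) J I = B_JI"
    "submatrix (assemble_blocks p I J B_II B_IJ B_JI B_JJ) J J = B_JJ"
    using carr by (auto intro!: eq_matI simp: submatrix_def assemble_blocks_def sets pI pJ)
qed

end

theory Submission
  imports Defs
begin

text \<open>
  Write \<open>B\<close>, \<open>D\<close>, \<open>F = D\<^sup>T\<close>, \<open>C\<close> for the blocks of \<open>A\<close> at \<open>I\<^sub>1 \<times> I\<^sub>1\<close>, \<open>I\<^sub>1 \<times> I\<^sub>2\<close>,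
  \<open>I\<^sub>2 \<times> I\<^sub>1\<close>, \<open>I\<^sub>2 \<times> I\<^sub>2\<close>, let \<open>Y\<close> be the \<open>I\<^sub>2 \<times> I\<^sub>2\<close> block of the inverse of \<open>A\<close>, and put
  \<open>M = C\<inverse> F B\<inverse> D\<close>. One complete iteration is the affine map
  \<open>X \<mapsto> C\<inverse> + M C\<inverse> + M X M\<^sup>T\<close>. The block equations of \<open>A H = 1\<close> give \<open>Y = C\<inverse> + M Y\<close>;
  transposing this and inserting it into itself shows that \<open>Y\<close> is a fixed point of the map. So an
  iteration sends the error \<open>E\<close> to \<open>M E M\<^sup>T\<close> (\<open>iteration_error\<close>), and after \<open>r\<close> iterations the
  error is \<open>M\<^sup>r E (M\<^sup>r)\<^sup>T\<close> (\<open>error_power\<close>). Since the Euclidean operator norm is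
  submultiplicative and invariant under transposition, its norm is at most
  \<open>\<parallel>M\<^sup>r\<parallel>\<^sup>2 \<parallel>E\<parallel>\<close>, and \<open>\<parallel>M\<^sup>r\<parallel>\<close> is at most the \<open>r\<close>-th power of \<open>\<parallel>M\<parallel>\<close>.

  The norm of \<open>M\<close> may well exceed \<open>1\<close>, so convergence does not follow from the rate. It follows
  from measuring vectors by the energy \<open>v\<^sup>T C v\<close> instead. The matrix \<open>S = C M = F B\<inverse> D\<close> is
  symmetric and positive semidefinite, and \<open>C - S\<close> is the Schur complement, the inverse of \<open>Y\<close>,
  hence positive definite. Therefore \<open>S \<le> q C\<close> as quadratic forms for some \<open>q < 1\<close>
  (\<open>strictly_dominated_form\<close>), and the Cauchy-Schwarz inequality for the form \<open>S\<close> turns this into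
  a contraction of the energy norm by the factor \<open>q\<close> (\<open>energy_contraction\<close>). The energy norm is
  equivalent to the Euclidean norm, so \<open>M\<^sup>r\<close> tends to \<open>0\<close>. The lower bound of a positive definite
  form by a multiple of \<open>v\<^sup>T v\<close>, on which both the constant \<open>q\<close> and this equivalence rest, comes
  from the boundedness of the inverse matrix (\<open>sym_pos_def_lower_bound\<close>).
\<close>

section \<open>Quadratic forms of symmetric matrices\<close>

lemma self_scalar_prod_nonneg: "0 \<le> v \<bullet> (v :: real vec)"
  by (auto simp: scalar_prod_def intro: sum_nonneg)

lemma self_scalar_prod_eq_0:
  fixes v :: "real vec"
  assumes "v \<in> carrier_vec n" "v \<bullet> v = 0"
  shows "v = 0\<^sub>v n"
proof -
  have "v $ i * v $ i = 0" if "i < n" for i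
    using assms that by (auto simp: scalar_prod_def sum_nonneg_eq_0_iff)
  then show ?thesis using assms(1) by (intro eq_vecI) auto
qed

lemma symmetric_form_commute:
  fixes P :: "real mat"
  assumes "P \<in> carrier_mat n n" "P\<^sup>T = P" "x \<in> carrier_vec n" "y \<in> carrier_vec n"
  shows "x \<bullet> (P *\<^sub>v y) = y \<bullet> (P *\<^sub>v x)"
proof -
  have "x \<bullet> (P *\<^sub>v y) = (P\<^sup>T *\<^sub>v x) \<bullet> y"
    by (rule transpose_vec_mult_scalar[symmetric]) (use assms in auto)
  also have "\<dots> = y \<bullet> (P *\<^sub>v x)"
    unfolding assms(2) by (rule comm_scalar_prod[where n = n]) (use assms in auto)
  finally show ?thesis .
qed

text \<open>
  The usual discriminant argument for \<open>t \<mapsto> (x + t y)\<^sup>T P (x + t y)\<close>. The form is only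
  semidefinite because the inequality is applied to \<open>F B\<inverse> D\<close>, which may be singular.
\<close>
lemma semidefinite_Cauchy_Schwarz:
  fixes P :: "real mat"
  assumes P: "P \<in> carrier_mat n n" "P\<^sup>T = P"
    and psd: "\<And>v. v \<in> carrier_vec n \<Longrightarrow> 0 \<le> v \<bullet> (P *\<^sub>v v)"
    and x: "x \<in> carrier_vec n" and y: "y \<in> carrier_vec n"
  shows "(x \<bullet> (P *\<^sub>v y))\<^sup>2 \<le> (x \<bullet> (P *\<^sub>v x)) * (y \<bullet> (P *\<^sub>v y))"
proof -
  define a b c where "a = x \<bullet> (P *\<^sub>v x)" and "b = x \<bullet> (P *\<^sub>v y)" and "c = y \<bullet> (P *\<^sub>v y)"
  have quad: "0 \<le> a + 2 * t * b + t\<^sup>2 * c" for t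
  proof -
    have "y \<bullet> (P *\<^sub>v x) = b"
      unfolding b_def by (rule symmetric_form_commute) (use P x y in auto)
    then have "(x + t \<cdot>\<^sub>v y) \<bullet> (P *\<^sub>v (x + t \<cdot>\<^sub>v y)) = a + 2 * t * b + t\<^sup>2 * c"
      using P x y
      by (simp add: mult_add_distrib_mat_vec[where nr = n and nc = n] mult_mat_vec[where nr = n and nc = n]
          scalar_prod_add_distrib[where n = n] add_scalar_prod_distrib[where n = n]
          a_def b_def c_def algebra_simps power2_eq_square)
    then show ?thesis using psd[of "x + t \<cdot>\<^sub>v y"] x y by simp
  qed
  have c0: "0 \<le> c" unfolding c_def using psd y .
  have "b\<^sup>2 \<le> a * c"
  proof (cases "c = 0")
    case True
    \<comment> \<open>The quadratic in \<open>t\<close> degenerates to an affine function bounded below, so its slope vanishes.\<close>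
    have "b = 0"
      using quad[of "- (a + 1) / (2 * b)"] True by (cases "b = 0") (auto simp: field_simps)
    then show ?thesis using True by simp
  next
    case False
    \<comment> \<open>Evaluate the quadratic at its minimum.\<close>
    show ?thesis using quad[of "- b / c"] False c0
      by (simp add: field_simps power2_eq_square)
  qed
  then show ?thesis by (simp add: a_def b_def c_def)
qed

lemma Cauchy_Schwarz_vec:
  fixes x y :: "real vec"
  assumes "x \<in> carrier_vec n" "y \<in> carrier_vec n"
  shows "(x \<bullet> y)\<^sup>2 \<le> (x \<bullet> x) * (y \<bullet> y)"
  using semidefinite_Cauchy_Schwarz[of "1\<^sub>m n" n x y] assms self_scalar_prod_nonneg by auto

section \<open>The induced Euclidean norm\<close>

lemma vec_norm2_nonneg [simp]: "0 \<le> vec_norm2 v"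
  by (simp add: vec_norm2_def self_scalar_prod_nonneg)

lemma vec_norm2_square: "(vec_norm2 v)\<^sup>2 = v \<bullet> v"
  by (simp add: vec_norm2_def self_scalar_prod_nonneg)

lemma scalar_prod_le_vec_norm2:
  assumes "x \<in> carrier_vec n" "y \<in> carrier_vec n"
  shows "x \<bullet> y \<le> vec_norm2 x * vec_norm2 y"
proof -
  have "x \<bullet> y \<le> sqrt ((x \<bullet> y)\<^sup>2)" by simp
  also have "\<dots> \<le> sqrt ((x \<bullet> x) * (y \<bullet> y))"
    using Cauchy_Schwarz_vec[OF assms] by (rule real_sqrt_le_mono)
  finally show ?thesis by (simp add: vec_norm2_def real_sqrt_mult)
qed

lemma vec_norm2_eq_0:
  assumes "v \<in> carrier_vec n" "vec_norm2 v = 0"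
  shows "v = 0\<^sub>v n"
  using self_scalar_prod_eq_0[OF assms(1)] assms(2) by (simp add: vec_norm2_def)

text \<open>Cauchy-Schwarz on each row bounds the induced norm by the Frobenius norm.\<close>
lemma mult_mat_vec_bounded:
  fixes M :: "real mat"
  assumes M: "M \<in> carrier_mat m n"
  obtains K where "\<And>v. v \<in> carrier_vec n \<Longrightarrow> vec_norm2 (M *\<^sub>v v) \<le> K * vec_norm2 v"
proof
  fix v :: "real vec" assume v: "v \<in> carrier_vec n"
  define F where "F = (\<Sum>i<m. row M i \<bullet> row M i)"
  have "(M *\<^sub>v v) \<bullet> (M *\<^sub>v v) = (\<Sum>i<m. (row M i \<bullet> v)\<^sup>2)"
    using M by (simp add: scalar_prod_def[of "M *\<^sub>v v"] power2_eq_square atLeast0LessThan)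
  also have "\<dots> \<le> (\<Sum>i<m. (row M i \<bullet> row M i) * (v \<bullet> v))"
    using M v by (intro sum_mono Cauchy_Schwarz_vec[where n = n]) auto
  also have "\<dots> = F * (v \<bullet> v)" by (simp add: F_def sum_distrib_right)
  finally show "vec_norm2 (M *\<^sub>v v) \<le> sqrt F * vec_norm2 v"
    unfolding vec_norm2_def by (simp flip: real_sqrt_mult)
qed

text \<open>
  A supremum of reals is meaningful only for a bounded set; this is what makes
  \<^const>\<open>mat_norm2\<close> an upper bound of its quotients.
\<close>
lemma bdd_above_norm_quotients:
  assumes M: "M \<in> carrier_mat m n"
  shows "bdd_above ((\<lambda>w. vec_norm2 (M *\<^sub>v w) / vec_norm2 w) ` carrier_vec n)"
proof -
  obtain K where K: "\<And>v. v \<in> carrier_vec n \<Longrightarrow> vec_norm2 (M *\<^sub>v v) \<le> K * vec_norm2 v"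
    using mult_mat_vec_bounded[OF M] by blast
  have "vec_norm2 (M *\<^sub>v w) / vec_norm2 w \<le> max K 0" if "w \<in> carrier_vec n" for w
  proof -
    have "vec_norm2 (M *\<^sub>v w) \<le> max K 0 * vec_norm2 w"
      by (rule order_trans[OF K[OF that]]) (simp add: mult_right_mono)
    then show ?thesis
      using vec_norm2_nonneg[of w] by (cases "vec_norm2 w = 0") (auto simp: pos_divide_le_eq less_le)
  qed
  then show ?thesis by (intro bdd_aboveI2) auto
qed

lemma vec_norm2_mult_le:
  assumes M: "M \<in> carrier_mat m n" and v: "v \<in> carrier_vec n"
  shows "vec_norm2 (M *\<^sub>v v) \<le> mat_norm2 M * vec_norm2 v"
proof (cases "vec_norm2 v = 0")
  case True
  then have "v = 0\<^sub>v n" by (rule vec_norm2_eq_0[OF v])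
  then have "M *\<^sub>v v = 0\<^sub>v m" using M by (intro eq_vecI) auto
  then show ?thesis using True by (simp add: vec_norm2_def)
next
  case False
  have "vec_norm2 (M *\<^sub>v v) / vec_norm2 v \<le> mat_norm2 M"
    unfolding mat_norm2_def using M v bdd_above_norm_quotients[OF M] by (intro cSUP_upper) auto
  then show ?thesis using False vec_norm2_nonneg[of v] by (simp add: field_simps)
qed

lemma mat_norm2_le:
  assumes M: "M \<in> carrier_mat m n" and c: "0 \<le> c"
    and le: "\<And>v. v \<in> carrier_vec n \<Longrightarrow> vec_norm2 (M *\<^sub>v v) \<le> c * vec_norm2 v"
  shows "mat_norm2 M \<le> c"
  unfolding mat_norm2_def
proof (rule cSUP_least)
  have "(0\<^sub>v (dim_col M) :: real vec) \<in> carrier_vec (dim_col M)" by simp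
  then show "(carrier_vec (dim_col M) :: real vec set) \<noteq> {}" by blast
  fix v :: "real vec" assume "v \<in> carrier_vec (dim_col M)"
  then have "v \<in> carrier_vec n" using M by auto
  from le[OF this] show "vec_norm2 (M *\<^sub>v v) / vec_norm2 v \<le> c"
    using c by (cases "vec_norm2 v = 0") (auto simp: pos_divide_le_eq less_le)
qed

lemma mat_norm2_nonneg:
  assumes M: "M \<in> carrier_mat m n"
  shows "0 \<le> mat_norm2 M"
proof -
  have "vec_norm2 (M *\<^sub>v 0\<^sub>v n) / vec_norm2 (0\<^sub>v n) \<le> mat_norm2 M"
    unfolding mat_norm2_def using M bdd_above_norm_quotients[OF M] by (intro cSUP_upper) auto
  then show ?thesis by (simp add: vec_norm2_def)
qed

lemma mat_norm2_mult_le: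
  assumes M: "M \<in> carrier_mat l m" and N: "N \<in> carrier_mat m n"
  shows "mat_norm2 (M * N) \<le> mat_norm2 M * mat_norm2 N"
proof (rule mat_norm2_le)
  show "M * N \<in> carrier_mat l n" using M N by simp
  show "0 \<le> mat_norm2 M * mat_norm2 N"
    using mat_norm2_nonneg[OF M] mat_norm2_nonneg[OF N] by simp
  fix v :: "real vec" assume v: "v \<in> carrier_vec n"
  have "vec_norm2 ((M * N) *\<^sub>v v) = vec_norm2 (M *\<^sub>v (N *\<^sub>v v))"
    using M N v by simp
  also have "\<dots> \<le> mat_norm2 M * vec_norm2 (N *\<^sub>v v)"
    by (rule vec_norm2_mult_le[OF M]) (use N v in simp)
  also have "\<dots> \<le> mat_norm2 M * (mat_norm2 N * vec_norm2 v)"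
    by (intro mult_left_mono vec_norm2_mult_le[OF N v] mat_norm2_nonneg[OF M])
  finally show "vec_norm2 ((M * N) *\<^sub>v v) \<le> mat_norm2 M * mat_norm2 N * vec_norm2 v"
    by (simp add: mult.assoc)
qed

text \<open>With \<open>w = M\<^sup>T v\<close>, bound \<open>w \<bullet> w = v \<bullet> M w\<close> by Cauchy-Schwarz and divide by the norm of \<open>w\<close>.\<close>
lemma mat_norm2_transpose_le:
  assumes M: "M \<in> carrier_mat m n"
  shows "mat_norm2 (M\<^sup>T) \<le> mat_norm2 M"
proof (rule mat_norm2_le)
  show "M\<^sup>T \<in> carrier_mat n m" using M by simp
  show "0 \<le> mat_norm2 M" by (rule mat_norm2_nonneg[OF M])
  fix v :: "real vec" assume v: "v \<in> carrier_vec m"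
  define w where "w = M\<^sup>T *\<^sub>v v"
  have w: "w \<in> carrier_vec n" using M v by (simp add: w_def)
  have "(vec_norm2 w)\<^sup>2 = (M\<^sup>T *\<^sub>v v) \<bullet> w" unfolding vec_norm2_square by (simp add: w_def)
  also have "\<dots> = v \<bullet> (M *\<^sub>v w)" by (rule transpose_vec_mult_scalar[OF M w v])
  also have "\<dots> \<le> vec_norm2 v * vec_norm2 (M *\<^sub>v w)"
    by (rule scalar_prod_le_vec_norm2) (use M v w in auto)
  also have "\<dots> \<le> vec_norm2 v * (mat_norm2 M * vec_norm2 w)"
    by (intro mult_left_mono vec_norm2_mult_le[OF M w]) simp
  finally have "vec_norm2 w * vec_norm2 w \<le> (mat_norm2 M * vec_norm2 v) * vec_norm2 w"
    by (simp add: power2_eq_square ac_simps)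
  then have "vec_norm2 w \<le> mat_norm2 M * vec_norm2 v"
    using mat_norm2_nonneg[OF M] vec_norm2_nonneg[of w]
    by (cases "vec_norm2 w = 0") (auto simp: mult_le_cancel_right less_le)
  then show "vec_norm2 (M\<^sup>T *\<^sub>v v) \<le> mat_norm2 M * vec_norm2 v" by (simp add: w_def)
qed

lemma mat_norm2_congruence_le:
  assumes M: "M \<in> carrier_mat m n" and N: "N \<in> carrier_mat n n"
  shows "mat_norm2 (M * N * M\<^sup>T) \<le> (mat_norm2 M)\<^sup>2 * mat_norm2 N"
proof -
  have "mat_norm2 (M * N * M\<^sup>T) \<le> mat_norm2 (M * N) * mat_norm2 (M\<^sup>T)"
    by (rule mat_norm2_mult_le) (use M N in auto)
  also have "\<dots> \<le> (mat_norm2 M * mat_norm2 N) * mat_norm2 M"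
    by (intro mult_mono mat_norm2_mult_le[OF M N] mat_norm2_transpose_le[OF M]
        mult_nonneg_nonneg mat_norm2_nonneg[OF M] mat_norm2_nonneg[OF N] mat_norm2_nonneg[of "M\<^sup>T" n m])
      (use M in auto)
  finally show ?thesis by (simp add: power2_eq_square ac_simps)
qed

lemma mat_norm2_pow_le:
  assumes M: "M \<in> carrier_mat n n"
  shows "mat_norm2 (M ^\<^sub>m r) \<le> mat_norm2 M ^ r"
proof (induction r)
  case 0
  have "mat_norm2 (1\<^sub>m n) \<le> 1" by (rule mat_norm2_le[of _ n n]) auto
  then show ?case using M by simp
next
  case (Suc r)
  have "mat_norm2 (M ^\<^sub>m Suc r) \<le> mat_norm2 (M ^\<^sub>m r) * mat_norm2 M"
    unfolding pow_mat.simps by (rule mat_norm2_mult_le) (use M in auto)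
  also have "\<dots> \<le> mat_norm2 M ^ r * mat_norm2 M"
    using Suc by (rule mult_right_mono) (rule mat_norm2_nonneg[OF M])
  finally show ?case by (simp add: mult.commute)
qed

section \<open>Positive definite matrices\<close>

lemma sym_pos_def_iff:
  assumes "P \<in> carrier_mat n n"
  shows "sym_pos_def P \<longleftrightarrow>
    P\<^sup>T = P \<and> (\<forall>v \<in> carrier_vec n. v \<noteq> 0\<^sub>v n \<longrightarrow> 0 < v \<bullet> (P *\<^sub>v v))"
  using assms by (auto simp: sym_pos_def_def)

lemma sym_pos_def_nonneg:
  assumes P: "P \<in> carrier_mat n n" and pd: "sym_pos_def P" and v: "v \<in> carrier_vec n"
  shows "0 \<le> v \<bullet> (P *\<^sub>v v)"
proof (cases "v = 0\<^sub>v n")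
  case True
  then show ?thesis using P by simp
next
  case False
  then show ?thesis using pd v unfolding sym_pos_def_iff[OF P] by (simp add: less_imp_le)
qed

text \<open>The substitution \<open>v = P w\<close> turns the form of the inverse at \<open>v\<close> into the form of \<open>P\<close> at \<open>w\<close>.\<close>
lemma sym_pos_def_right_inverse:
  assumes P: "P \<in> carrier_mat n n" and pd: "sym_pos_def P"
    and R: "R \<in> carrier_mat n n" and PR: "P * R = 1\<^sub>m n"
  shows "sym_pos_def R"
  unfolding sym_pos_def_iff[OF R]
proof (intro conjI ballI impI)
  have sym: "P\<^sup>T = P" using pd unfolding sym_pos_def_iff[OF P] by simp
  have RTP: "R\<^sup>T * P = 1\<^sub>m n"
    using arg_cong[OF PR, of transpose_mat] P R by (simp add: transpose_mult[of P n n] sym)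
  have "R\<^sup>T = R\<^sup>T * (P * R)" using R by (simp add: PR)
  also have "\<dots> = (R\<^sup>T * P) * R" using P R by (simp add: assoc_mult_mat[of _ n n _ n _ n])
  also have "\<dots> = R" using R by (simp add: RTP)
  finally show "R\<^sup>T = R" .
  fix v :: "real vec" assume v: "v \<in> carrier_vec n" "v \<noteq> 0\<^sub>v n"
  define w where "w = R *\<^sub>v v"
  have w: "w \<in> carrier_vec n" using R v by (simp add: w_def)
  have Pw: "P *\<^sub>v w = v"
    using P R v PR by (simp add: w_def assoc_mult_mat_vec[of P n n R n, symmetric])
  have "w \<noteq> 0\<^sub>v n"
  proof
    assume "w = 0\<^sub>v n"
    then have "P *\<^sub>v w = 0\<^sub>v n" using P by (intro eq_vecI) auto
    then show False using Pw v by simp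
  qed
  then have "0 < w \<bullet> (P *\<^sub>v w)" using pd w unfolding sym_pos_def_iff[OF P] by simp
  also have "\<dots> = v \<bullet> (R *\<^sub>v v)"
    unfolding Pw unfolding w_def by (rule comm_scalar_prod[where n = n]) (use R v in auto)
  finally show "0 < v \<bullet> (R *\<^sub>v v)" .
qed

lemma form_upper_bound:
  fixes P :: "real mat"
  assumes P: "P \<in> carrier_mat n n"
  obtains K where "0 < K" "\<And>v. v \<in> carrier_vec n \<Longrightarrow> v \<bullet> (P *\<^sub>v v) \<le> K * (v \<bullet> v)"
proof
  show "0 < mat_norm2 P + 1" using mat_norm2_nonneg[OF P] by simp
  fix v :: "real vec" assume v: "v \<in> carrier_vec n"
  have "v \<bullet> (P *\<^sub>v v) \<le> vec_norm2 v * vec_norm2 (P *\<^sub>v v)"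
    by (rule scalar_prod_le_vec_norm2) (use P v in auto)
  also have "\<dots> \<le> vec_norm2 v * (mat_norm2 P * vec_norm2 v)"
    by (intro mult_left_mono vec_norm2_mult_le[OF P v]) simp
  also have "\<dots> = mat_norm2 P * (v \<bullet> v)"
    by (simp add: vec_norm2_square[symmetric] power2_eq_square)
  also have "\<dots> \<le> (mat_norm2 P + 1) * (v \<bullet> v)"
    by (intro mult_right_mono) (auto simp: self_scalar_prod_nonneg)
  finally show "v \<bullet> (P *\<^sub>v v) \<le> (mat_norm2 P + 1) * (v \<bullet> v)" .
qed

text \<open>
  Write \<open>v \<bullet> v\<close> as the \<open>P\<close>-product of \<open>v\<close> and \<open>P\<inverse> v\<close>. Cauchy-Schwarz for the form \<open>P\<close> gives
  \<open>(v \<bullet> v)\<^sup>2 \<le> (v \<bullet> P v) (v \<bullet> P\<inverse> v)\<close>, and the last factor is at most \<open>K (v \<bullet> v)\<close>.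
\<close>
lemma sym_pos_def_lower_bound:
  assumes P: "P \<in> carrier_mat n n" and pd: "sym_pos_def P"
  obtains c where "0 < c" "\<And>v. v \<in> carrier_vec n \<Longrightarrow> c * (v \<bullet> v) \<le> v \<bullet> (P *\<^sub>v v)"
proof -
  define R where "R = mat_inv P"
  note inv = sym_pos_def_mat_inv[OF P pd, folded R_def]
  obtain K where K: "0 < K" "\<And>v. v \<in> carrier_vec n \<Longrightarrow> v \<bullet> (R *\<^sub>v v) \<le> K * (v \<bullet> v)"
    using form_upper_bound[OF inv(1)] by blast
  have "1 / K * (v \<bullet> v) \<le> v \<bullet> (P *\<^sub>v v)" if v: "v \<in> carrier_vec n" for v
  proof (cases "v \<bullet> v = 0")
    case True
    then show ?thesis using sym_pos_def_nonneg[OF P pd v] by simp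
  next
    case False
    then have pos: "0 < v \<bullet> v" using self_scalar_prod_nonneg[of v] by simp
    have PRv: "P *\<^sub>v (R *\<^sub>v v) = v"
      using P inv v by (simp add: assoc_mult_mat_vec[of P n n R n, symmetric])
    have "(v \<bullet> v)\<^sup>2 = (v \<bullet> (P *\<^sub>v (R *\<^sub>v v)))\<^sup>2" by (simp add: PRv)
    also have "\<dots> \<le> (v \<bullet> (P *\<^sub>v v)) * ((R *\<^sub>v v) \<bullet> (P *\<^sub>v (R *\<^sub>v v)))"
      by (rule semidefinite_Cauchy_Schwarz[OF P _ sym_pos_def_nonneg[OF P pd]])
        (use pd inv v in \<open>auto simp: sym_pos_def_iff[OF P]\<close>)
    also have "(R *\<^sub>v v) \<bullet> (P *\<^sub>v (R *\<^sub>v v)) = v \<bullet> (R *\<^sub>v v)"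
      unfolding PRv by (rule comm_scalar_prod[where n = n]) (use inv v in auto)
    also have "(v \<bullet> (P *\<^sub>v v)) * (v \<bullet> (R *\<^sub>v v)) \<le> (v \<bullet> (P *\<^sub>v v)) * (K * (v \<bullet> v))"
      by (intro mult_left_mono K(2) v sym_pos_def_nonneg[OF P pd v])
    finally have "(v \<bullet> v) * (v \<bullet> v) \<le> ((v \<bullet> (P *\<^sub>v v)) * K) * (v \<bullet> v)"
      by (simp add: power2_eq_square ac_simps)
    then show ?thesis using pos K(1) by (simp add: mult_le_cancel_right field_simps)
  qed
  then show ?thesis using K(1) that[of "1 / K"] by simp
qed

section \<open>Powers of a matrix that contracts an energy norm\<close>

text \<open>
  If \<open>C - S\<close> is bounded below by \<open>c\<close> and \<open>C\<close> above by \<open>K\<close>, then \<open>C - S \<ge> (c / K) C\<close>, that is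
  \<open>S \<le> (1 - c / K) C\<close>. For \<open>c > K\<close> the factor is negative and is replaced by \<open>0\<close>,
  which weakens the bound only where the energy is nonnegative.
\<close>
lemma strictly_dominated_form:
  assumes C: "C \<in> carrier_mat n n" and S: "S \<in> carrier_mat n n"
    and pd: "sym_pos_def (C - S)"
  obtains q where "0 \<le> q" "q < 1"
    "\<And>v. v \<in> carrier_vec n \<Longrightarrow> 0 \<le> v \<bullet> (C *\<^sub>v v) \<Longrightarrow> v \<bullet> (S *\<^sub>v v) \<le> q * (v \<bullet> (C *\<^sub>v v))"
proof -
  have CS: "C - S \<in> carrier_mat n n" using S by (rule minus_carrier_mat)
  obtain c where c: "0 < c" "\<And>v. v \<in> carrier_vec n \<Longrightarrow> c * (v \<bullet> v) \<le> v \<bullet> ((C - S) *\<^sub>v v)"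
    using sym_pos_def_lower_bound[OF CS pd] by blast
  obtain K where K: "0 < K" "\<And>v. v \<in> carrier_vec n \<Longrightarrow> v \<bullet> (C *\<^sub>v v) \<le> K * (v \<bullet> v)"
    using form_upper_bound[OF C] by blast
  define q where "q = max 0 (1 - c / K)"
  have "v \<bullet> (S *\<^sub>v v) \<le> q * (v \<bullet> (C *\<^sub>v v))"
    if v: "v \<in> carrier_vec n" and nn: "0 \<le> v \<bullet> (C *\<^sub>v v)" for v
  proof -
    have "c / K * (v \<bullet> (C *\<^sub>v v)) \<le> c / K * (K * (v \<bullet> v))"
      by (rule mult_left_mono[OF K(2)[OF v]]) (use c K in simp)
    also have "\<dots> = c * (v \<bullet> v)" using K(1) by simp
    also have "\<dots> \<le> v \<bullet> ((C - S) *\<^sub>v v)" by (rule c(2)[OF v])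
    also have "\<dots> = v \<bullet> (C *\<^sub>v v) - v \<bullet> (S *\<^sub>v v)"
      using C S v by (simp add: minus_mult_distrib_mat_vec[OF C S v] scalar_prod_minus_distrib[where n = n])
    finally have "v \<bullet> (S *\<^sub>v v) \<le> (1 - c / K) * (v \<bullet> (C *\<^sub>v v))" by (simp add: algebra_simps)
    also have "\<dots> \<le> q * (v \<bullet> (C *\<^sub>v v))"
      by (rule mult_right_mono[OF _ nn]) (simp add: q_def)
    finally show ?thesis .
  qed
  moreover have "0 \<le> q" "q < 1" using c K by (auto simp: q_def)
  ultimately show ?thesis using that by blast
qed

text \<open>
  With \<open>u = M w\<close>, the energy \<open>u \<bullet> C u\<close> equals \<open>u \<bullet> S w\<close>. Cauchy-Schwarz for \<open>S\<close> and \<open>S \<le> q C\<close>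
  bound its square by \<open>q\<^sup>2 (u \<bullet> C u) (w \<bullet> C w)\<close>.
\<close>
lemma energy_contraction:
  assumes C: "C \<in> carrier_mat n n" "sym_pos_def C"
    and S: "S \<in> carrier_mat n n" "S\<^sup>T = S"
    and psd: "\<And>v. v \<in> carrier_vec n \<Longrightarrow> 0 \<le> v \<bullet> (S *\<^sub>v v)"
    and q: "0 \<le> q" "\<And>v. v \<in> carrier_vec n \<Longrightarrow> v \<bullet> (S *\<^sub>v v) \<le> q * (v \<bullet> (C *\<^sub>v v))"
    and M: "M \<in> carrier_mat n n" "C * M = S"
    and w: "w \<in> carrier_vec n"
  shows "(M *\<^sub>v w) \<bullet> (C *\<^sub>v (M *\<^sub>v w)) \<le> q\<^sup>2 * (w \<bullet> (C *\<^sub>v w))"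
proof -
  define u where "u = M *\<^sub>v w"
  have u: "u \<in> carrier_vec n" using M w by (simp add: u_def)
  have Cu: "C *\<^sub>v u = S *\<^sub>v w"
    unfolding u_def M(2)[symmetric] by (rule assoc_mult_mat_vec[symmetric]) (use C M w in auto)
  define a b where "a = u \<bullet> (C *\<^sub>v u)" and "b = w \<bullet> (C *\<^sub>v w)"
  have a: "0 \<le> a" and b: "0 \<le> b"
    unfolding a_def b_def by (rule sym_pos_def_nonneg[OF C u], rule sym_pos_def_nonneg[OF C w])
  have "a\<^sup>2 = (u \<bullet> (S *\<^sub>v w))\<^sup>2" by (simp add: a_def Cu)
  also have "\<dots> \<le> (u \<bullet> (S *\<^sub>v u)) * (w \<bullet> (S *\<^sub>v w))"
    by (rule semidefinite_Cauchy_Schwarz[OF S psd u w])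
  also have "\<dots> \<le> (q * a) * (q * b)"
    unfolding a_def b_def
    by (intro mult_mono q psd u w mult_nonneg_nonneg sym_pos_def_nonneg[OF C u])
  finally have "a * a \<le> (q\<^sup>2 * b) * a" by (simp add: power2_eq_square ac_simps)
  then have "a \<le> q\<^sup>2 * b" using a b
    by (cases "a = 0") (auto simp: mult_le_cancel_right less_le)
  then show ?thesis by (simp add: a_def b_def u_def)
qed

lemma energy_contraction_powers_tendsto_0:
  assumes C: "C \<in> carrier_mat n n" "sym_pos_def C"
    and M: "M \<in> carrier_mat n n"
    and q: "0 \<le> q" "q < 1"
    and contr: "\<And>w. w \<in> carrier_vec n \<Longrightarrow>
      (M *\<^sub>v w) \<bullet> (C *\<^sub>v (M *\<^sub>v w)) \<le> q\<^sup>2 * (w \<bullet> (C *\<^sub>v w))"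
  shows "(\<lambda>r. mat_norm2 (M ^\<^sub>m r)) \<longlonglongrightarrow> 0"
proof -
  obtain c where c: "0 < c" "\<And>v. v \<in> carrier_vec n \<Longrightarrow> c * (v \<bullet> v) \<le> v \<bullet> (C *\<^sub>v v)"
    using sym_pos_def_lower_bound[OF C] by blast
  obtain K where K: "0 < K" "\<And>v. v \<in> carrier_vec n \<Longrightarrow> v \<bullet> (C *\<^sub>v v) \<le> K * (v \<bullet> v)"
    using form_upper_bound[OF C(1)] by blast
  have pow: "((M ^\<^sub>m r) *\<^sub>v w) \<bullet> (C *\<^sub>v ((M ^\<^sub>m r) *\<^sub>v w)) \<le> (q ^ r)\<^sup>2 * (w \<bullet> (C *\<^sub>v w))"
    if "w \<in> carrier_vec n" for r w
    using that
  proof (induction r arbitrary: w)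
    case 0
    then show ?case using M by simp
  next
    case (Suc r)
    have Mw: "M *\<^sub>v w \<in> carrier_vec n" using M Suc.prems by simp
    have "(M ^\<^sub>m Suc r) *\<^sub>v w = (M ^\<^sub>m r) *\<^sub>v (M *\<^sub>v w)"
      unfolding pow_mat.simps by (rule assoc_mult_mat_vec) (use M Suc.prems in auto)
    then have "((M ^\<^sub>m Suc r) *\<^sub>v w) \<bullet> (C *\<^sub>v ((M ^\<^sub>m Suc r) *\<^sub>v w))
        \<le> (q ^ r)\<^sup>2 * ((M *\<^sub>v w) \<bullet> (C *\<^sub>v (M *\<^sub>v w)))"
      using Suc.IH[OF Mw] by simp
    also have "\<dots> \<le> (q ^ r)\<^sup>2 * (q\<^sup>2 * (w \<bullet> (C *\<^sub>v w)))"
      by (rule mult_left_mono[OF contr[OF Suc.prems]]) simp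
    finally show ?case by (simp add: power2_eq_square ac_simps)
  qed
  have bound: "mat_norm2 (M ^\<^sub>m r) \<le> sqrt (K / c) * q ^ r" for r
  proof (rule mat_norm2_le)
    show "M ^\<^sub>m r \<in> carrier_mat n n" using M by simp
    show "0 \<le> sqrt (K / c) * q ^ r" using c K q by simp
    fix v :: "real vec" assume v: "v \<in> carrier_vec n"
    define u where "u = (M ^\<^sub>m r) *\<^sub>v v"
    have u: "u \<in> carrier_vec n" unfolding u_def
      using mult_mat_vec_carrier[OF pow_carrier_mat[OF M] v] .
    have "c * (u \<bullet> u) \<le> u \<bullet> (C *\<^sub>v u)" by (rule c(2)[OF u])
    also have "\<dots> \<le> (q ^ r)\<^sup>2 * (v \<bullet> (C *\<^sub>v v))" using pow[OF v] by (simp add: u_def)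
    also have "\<dots> \<le> (q ^ r)\<^sup>2 * (K * (v \<bullet> v))" by (rule mult_left_mono[OF K(2)[OF v]]) simp
    finally have "u \<bullet> u \<le> K / c * (q ^ r)\<^sup>2 * (v \<bullet> v)" using c(1) by (simp add: field_simps)
    then have "vec_norm2 u \<le> sqrt (K / c * (q ^ r)\<^sup>2 * (v \<bullet> v))" by (simp add: vec_norm2_def)
    also have "\<dots> = sqrt (K / c) * q ^ r * vec_norm2 v"
      using q by (simp only: real_sqrt_mult vec_norm2_def) simp
    finally show "vec_norm2 ((M ^\<^sub>m r) *\<^sub>v v) \<le> sqrt (K / c) * q ^ r * vec_norm2 v"
      by (simp add: u_def)
  qed
  have "(\<lambda>r. sqrt (K / c) * q ^ r) \<longlonglongrightarrow> sqrt (K / c) * 0"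
    using q by (intro tendsto_mult tendsto_const LIMSEQ_power_zero) simp
  then show ?thesis
    using tendsto_sandwich[of "\<lambda>_. 0" "\<lambda>r. mat_norm2 (M ^\<^sub>m r)" sequentially
        "\<lambda>r. sqrt (K / c) * q ^ r" 0]
      bound mat_norm2_nonneg[OF pow_carrier_mat[OF M]] by auto
qed

section \<open>Sub-matrices and block multiplication\<close>

lemma bij_betw_pick:
  assumes "finite I"
  shows "bij_betw (pick I) {0..<card I} I"
proof (rule bij_betw_byWitness[where f' = "\<lambda>i. card {a \<in> I. a < i}"])
  show "\<forall>k \<in> {0..<card I}. card {a \<in> I. a < pick I k} = k"
    using card_pick_le by simp
  show "\<forall>i \<in> I. pick I (card {a \<in> I. a < i}) = i"
    using pick_card_in_set by simp
  show "pick I ` {0..<card I} \<subseteq> I"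
    using pick_in_set_le by auto
  have "card {a \<in> I. a < i} < card I" if "i \<in> I" for i
    by (rule psubset_card_mono[OF assms]) (use that in auto)
  then show "(\<lambda>i. card {a \<in> I. a < i}) ` I \<subseteq> {0..<card I}"
    by auto
qed

lemma submatrix_carrier:
  assumes "M \<in> carrier_mat p p" "I \<subseteq> {0..<p}" "J \<subseteq> {0..<p}"
  shows "submatrix M I J \<in> carrier_mat (card I) (card J)"
proof -
  have sets: "{i. i < p \<and> i \<in> I} = I" "{i. i < p \<and> i \<in> J} = J" using assms by auto
  show ?thesis using assms(1) by (intro carrier_matI) (simp_all add: dim_submatrix sets)
qed

lemma submatrix_nth:
  assumes "M \<in> carrier_mat p p" "I \<subseteq> {0..<p}" "J \<subseteq> {0..<p}" "i < card I" "j < card J"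
  shows "submatrix M I J $$ (i, j) = M $$ (pick I i, pick J j)"
proof -
  have sets: "{i. i < p \<and> i \<in> I} = I" "{i. i < p \<and> i \<in> J} = J" using assms by auto
  show ?thesis using assms(1,4,5) by (intro submatrix_index) (simp_all add: sets)
qed

lemma pick_less:
  assumes "I \<subseteq> {0..<p}" "i < card I"
  shows "pick I i < p"
  using pick_in_set_le[OF assms(2)] assms(1) by auto

lemma submatrix_transpose:
  assumes "M \<in> carrier_mat p p" "I \<subseteq> {0..<p}" "J \<subseteq> {0..<p}"
  shows "(submatrix M I J)\<^sup>T = submatrix (M\<^sup>T) J I"
  using assms submatrix_carrier[OF assms] submatrix_carrier[of "M\<^sup>T" p J I]
  by (intro eq_matI) (auto simp: submatrix_nth[of _ p] pick_less)

lemma submatrix_one: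
  assumes "I \<subseteq> {0..<p}"
  shows "submatrix (1\<^sub>m p) I I = 1\<^sub>m (card I)"
proof -
  have "finite I" using assms finite_subset by blast
  then have "inj_on (pick I) {0..<card I}" using bij_betw_pick bij_betw_imp_inj_on by blast
  then have inj: "pick I i = pick I j \<longleftrightarrow> i = j" if "i < card I" "j < card I" for i j
    using that by (auto dest: inj_onD)
  show ?thesis using assms submatrix_carrier[of "1\<^sub>m p" p I I]
    by (intro eq_matI) (auto simp: submatrix_nth[of _ p] pick_less inj)
qed

lemma submatrix_one_disjoint:
  assumes "I \<subseteq> {0..<p}" "J \<subseteq> {0..<p}" "I \<inter> J = {}"
  shows "submatrix (1\<^sub>m p) I J = 0\<^sub>m (card I) (card J)"
proof -
  have neq: "pick I i \<noteq> pick J j" if "i < card I" "j < card J" for i j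
    using pick_in_set_le[of i I] pick_in_set_le[of j J] that assms(3) by auto
  show ?thesis using assms submatrix_carrier[of "1\<^sub>m p" p I J]
    by (intro eq_matI) (auto simp: submatrix_nth[of _ p] pick_less neq)
qed

text \<open>Split the inner summation index by the partition and enumerate each part with \<^const>\<open>pick\<close>.\<close>
lemma submatrix_mult:
  fixes M N :: "real mat"
  assumes M: "M \<in> carrier_mat p p" and N: "N \<in> carrier_mat p p"
    and part: "K \<union> L = {0..<p}" "K \<inter> L = {}"
    and I: "I \<subseteq> {0..<p}" and J: "J \<subseteq> {0..<p}"
  shows "submatrix (M * N) I J
    = submatrix M I K * submatrix N K J + submatrix M I L * submatrix N L J"
proof -
  have K: "K \<subseteq> {0..<p}" and L: "L \<subseteq> {0..<p}" using part by auto
  then have fin: "finite K" "finite L" using finite_subset by blast+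
  note carr = submatrix_carrier[OF M I K] submatrix_carrier[OF M I L]
    submatrix_carrier[OF N K J] submatrix_carrier[OF N L J]
    submatrix_carrier[of "M * N" p, OF _ I J]
  show ?thesis
  proof (rule eq_matI)
    fix i j
    assume "i < dim_row (submatrix M I K * submatrix N K J + submatrix M I L * submatrix N L J)"
      and "j < dim_col (submatrix M I K * submatrix N K J + submatrix M I L * submatrix N L J)"
    then have ij: "i < card I" "j < card J" using carr by auto
    define f where "f k = M $$ (pick I i, k) * N $$ (k, pick J j)" for k
    have prod: "(submatrix M I Q * submatrix N Q J) $$ (i, j) = sum f Q"
      if Q: "Q \<subseteq> {0..<p}" "finite Q" for Q
    proof -
      have "(submatrix M I Q * submatrix N Q J) $$ (i, j) = (\<Sum>k \<in> {0..<card Q}. f (pick Q k))"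
        using ij submatrix_carrier[OF M I Q(1)] submatrix_carrier[OF N Q(1) J]
        by (auto simp: scalar_prod_def submatrix_nth[OF M I Q(1)] submatrix_nth[OF N Q(1) J] f_def
            intro!: sum.cong)
      also have "\<dots> = sum f Q" by (rule sum.reindex_bij_betw[OF bij_betw_pick[OF Q(2)]])
      finally show ?thesis .
    qed
    have "submatrix (M * N) I J $$ (i, j) = sum f {0..<p}"
      using ij M N I J
      by (simp add: submatrix_nth[of _ p] pick_less scalar_prod_def f_def)
    also have "\<dots> = sum f K + sum f L"
      unfolding part(1)[symmetric] by (rule sum.union_disjoint[OF fin part(2)])
    finally show "submatrix (M * N) I J $$ (i, j)
        = (submatrix M I K * submatrix N K J + submatrix M I L * submatrix N L J) $$ (i, j)"
      using ij carr prod[OF K fin(1)] prod[OF L fin(2)] by simp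
  qed (use carr M N in auto)
qed

text \<open>
  Extending \<open>v\<close> by zeros outside \<open>I\<close> gives a vector at which the form of \<open>A\<close> has the value of the
  form of the principal sub-matrix at \<open>v\<close>.
\<close>
lemma sym_pos_def_submatrix:
  assumes A: "A \<in> carrier_mat p p" and pd: "sym_pos_def A" and I: "I \<subseteq> {0..<p}"
  shows "sym_pos_def (submatrix A I I)"
proof -
  note carr = submatrix_carrier[OF A I I]
  have fin: "finite I" using I finite_subset by blast
  show ?thesis unfolding sym_pos_def_iff[OF carr]
  proof (intro conjI ballI impI)
    show "(submatrix A I I)\<^sup>T = submatrix A I I"
      using submatrix_transpose[OF A I I] pd unfolding sym_pos_def_iff[OF A] by simp
    fix v :: "real vec" assume v: "v \<in> carrier_vec (card I)" "v \<noteq> 0\<^sub>v (card I)"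
    define w where "w = vec p (\<lambda>i. if i \<in> I then v $ card {a \<in> I. a < i} else 0)"
    have w: "w \<in> carrier_vec p" by (simp add: w_def)
    have w_pick: "w $ pick I k = v $ k" if "k < card I" for k
      using that pick_less[OF I that] pick_in_set_le[OF that] by (simp add: w_def card_pick_le)
    have sum_w: "(\<Sum>k \<in> {0..<card I}. f (pick I k) * v $ k) = (\<Sum>i \<in> {0..<p}. f i * w $ i)"
      for f :: "nat \<Rightarrow> real"
    proof -
      have "(\<Sum>k \<in> {0..<card I}. f (pick I k) * v $ k)
          = (\<Sum>k \<in> {0..<card I}. f (pick I k) * w $ pick I k)"
        by (simp add: w_pick)
      also have "\<dots> = (\<Sum>i \<in> I. f i * w $ i)" by (rule sum.reindex_bij_betw[OF bij_betw_pick[OF fin]])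
      also have "\<dots> = (\<Sum>i \<in> {0..<p}. f i * w $ i)"
        by (rule sum.mono_neutral_left) (use I in \<open>auto simp: w_def\<close>)
      finally show ?thesis .
    qed
    have Av: "(submatrix A I I *\<^sub>v v) $ k = (A *\<^sub>v w) $ pick I k" if k: "k < card I" for k
    proof -
      have "(submatrix A I I *\<^sub>v v) $ k = (\<Sum>l \<in> {0..<card I}. A $$ (pick I k, pick I l) * v $ l)"
        using k carr v by (simp add: scalar_prod_def submatrix_nth[OF A I I])
      also have "\<dots> = (\<Sum>i \<in> {0..<p}. A $$ (pick I k, i) * w $ i)" by (rule sum_w)
      also have "\<dots> = (A *\<^sub>v w) $ pick I k"
        using pick_less[OF I k] A w by (simp add: scalar_prod_def)
      finally show ?thesis .
    qed
    have "v \<bullet> (submatrix A I I *\<^sub>v v) = (\<Sum>k \<in> {0..<card I}. (A *\<^sub>v w) $ pick I k * v $ k)"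
      using carr by (auto simp: scalar_prod_def[of v] Av mult.commute simp del: index_mult_mat_vec
          intro!: sum.cong)
    also have "\<dots> = (\<Sum>i \<in> {0..<p}. (A *\<^sub>v w) $ i * w $ i)" by (rule sum_w)
    also have "\<dots> = w \<bullet> (A *\<^sub>v w)"
      using A by (auto simp: scalar_prod_def[of w] mult.commute simp del: index_mult_mat_vec
          intro!: sum.cong)
    finally have form: "v \<bullet> (submatrix A I I *\<^sub>v v) = w \<bullet> (A *\<^sub>v w)" .
    have "w \<noteq> 0\<^sub>v p"
    proof
      assume "w = 0\<^sub>v p"
      then have "v $ k = 0" if "k < card I" for k
        using w_pick[OF that] pick_less[OF I that] by simp
      then show False using v by (auto intro!: eq_vecI)
    qed
    then show "0 < v \<bullet> (submatrix A I I *\<^sub>v v)"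
      unfolding form using pd w unfolding sym_pos_def_iff[OF A] by simp
  qed
qed

section \<open>The error of the two-block iteration\<close>

text \<open>
  The ring laws with conditions on dimensions instead of carriers: the simplifier can discharge these
  for products of rectangular matrices, where the carrier versions leave inner dimensions to guess.
\<close>
lemma mult_assoc_dims:
  "dim_col P = dim_row Q \<Longrightarrow> dim_col Q = dim_row R \<Longrightarrow> (P * Q) * R = P * (Q * R)"
  for P Q R :: "real mat"
  by (rule assoc_mult_mat) auto

lemma mult_add_dims:
  "dim_col P = dim_row Q \<Longrightarrow> dim_row Q = dim_row R \<Longrightarrow> dim_col Q = dim_col R
    \<Longrightarrow> P * (Q + R) = P * Q + P * R"
  for P Q R :: "real mat"
  by (rule mult_add_distrib_mat) auto

lemma add_mult_dims:
  "dim_row P = dim_row Q \<Longrightarrow> dim_col P = dim_col Q \<Longrightarrow> dim_col Q = dim_row R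
    \<Longrightarrow> (P + Q) * R = P * R + Q * R"
  for P Q R :: "real mat"
  by (rule add_mult_distrib_mat) auto

text \<open>
  Block elimination: the equation \<open>upper\<close> gives \<open>Z = - B\<inverse> D Y\<close>, and inserting this into \<open>lower\<close>,
  multiplied by \<open>C\<inverse>\<close>, gives the claim.
\<close>
lemma block_inverse_fixpoint:
  fixes B C D F Bi Ci Y Z :: "real mat"
  assumes dims: "B \<in> carrier_mat m m" "C \<in> carrier_mat n n" "D \<in> carrier_mat m n"
      "F \<in> carrier_mat n m" "Bi \<in> carrier_mat m m" "Ci \<in> carrier_mat n n"
      "Y \<in> carrier_mat n n" "Z \<in> carrier_mat m n"
    and inv: "Bi * B = 1\<^sub>m m" "Ci * C = 1\<^sub>m n"
    and upper: "B * Z + D * Y = 0\<^sub>m m n" and lower: "F * Z + C * Y = 1\<^sub>m n"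
  shows "Y = Ci + Ci * F * Bi * D * Y"
proof -
  note dim = dims[THEN carrier_matD(1)] dims[THEN carrier_matD(2)]
  have "Z + Bi * D * Y = Bi * B * Z + Bi * D * Y" using dims inv by simp
  also have "\<dots> = Bi * (B * Z + D * Y)"
    by (simp add: dim mult_assoc_dims mult_add_dims del: assoc_mult_mat)
  also have "\<dots> = 0\<^sub>m m n" using dims by (simp add: upper)
  finally have 1: "Z + Bi * D * Y = 0\<^sub>m m n" .
  have "Ci * F * Z + Y = Ci * F * Z + Ci * C * Y" using dims inv by simp
  also have "\<dots> = Ci * (F * Z + C * Y)"
    by (simp add: dim mult_assoc_dims mult_add_dims del: assoc_mult_mat)
  also have "\<dots> = Ci" using dims by (simp add: lower)
  finally have 2: "Ci * F * Z + Y = Ci" .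
  have "Ci + Ci * F * Bi * D * Y = (Ci * F * Z + Y) + Ci * F * (Bi * D * Y)"
    unfolding 2 by (simp add: dim mult_assoc_dims del: assoc_mult_mat)
  also have "\<dots> = (Ci * F * Z + Ci * F * (Bi * D * Y)) + Y"
    by (intro eq_matI) (simp_all add: dim)
  also have "\<dots> = Ci * F * (Z + Bi * D * Y) + Y"
    by (simp add: dim mult_add_dims del: assoc_mult_mat)
  also have "\<dots> = Y" unfolding 1 using dims by simp
  finally show ?thesis by simp
qed

text \<open>
  Transposing the equation for \<open>Y\<close> gives \<open>Y = Ci + Y M\<^sup>T\<close>. Substituting this for the \<open>Y\<close> on the
  right of \<open>Y = Ci + M Y\<close> shows that \<open>Y\<close> is a fixed point of \<open>X \<mapsto> Ci + M Ci + M X M\<^sup>T\<close>, whose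
  linear part is \<open>X \<mapsto> M X M\<^sup>T\<close>.
\<close>
lemma iteration_error:
  fixes M Ci X Y :: "real mat"
  assumes dims: "M \<in> carrier_mat n n" "Ci \<in> carrier_mat n n" "X \<in> carrier_mat n n"
      "Y \<in> carrier_mat n n"
    and symm: "Ci\<^sup>T = Ci" "Y\<^sup>T = Y" and fix_Y: "Y = Ci + M * Y"
  shows "(Ci + M * Ci + M * X * M\<^sup>T) - Y = M * (X - Y) * M\<^sup>T"
proof -
  have "Y = (Ci + M * Y)\<^sup>T" unfolding fix_Y[symmetric] by (rule symm(2)[symmetric])
  also have "\<dots> = Ci + Y * M\<^sup>T"
    using dims by (simp add: transpose_add[of _ n n] transpose_mult[of _ n n] symm)
  finally have "M * Y = M * (Ci + Y * M\<^sup>T)" by (rule arg_cong)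
  also have "\<dots> = M * Ci + M * Y * M\<^sup>T"
    using dims by (simp add: mult_add_distrib_mat[of _ n n _ n] assoc_mult_mat[of _ n n _ n _ n])
  finally have "Ci + M * Y = Ci + (M * Ci + M * Y * M\<^sup>T)" by (rule arg_cong)
  with fix_Y have *: "Y = Ci + (M * Ci + M * Y * M\<^sup>T)" by (rule trans)
  have "M * (X - Y) * M\<^sup>T = M * X * M\<^sup>T - M * Y * M\<^sup>T"
    using dims by (simp add: mult_minus_distrib_mat[of _ n n _ n] minus_mult_distrib_mat[of _ n n _ _ n])
  also have "\<dots> = (Ci + M * Ci + M * X * M\<^sup>T) - (Ci + (M * Ci + M * Y * M\<^sup>T))"
    using dims by (intro eq_matI) auto
  finally show ?thesis unfolding *[symmetric] by (rule sym)
qed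

lemma error_power:
  fixes M :: "real mat"
  assumes M: "M \<in> carrier_mat n n" and E0: "E 0 \<in> carrier_mat n n"
    and step: "\<And>r. E (Suc r) = M * E r * M\<^sup>T"
  shows "E r = (M ^\<^sub>m r) * E 0 * (M ^\<^sub>m r)\<^sup>T"
proof (induction r)
  case 0
  then show ?case using M E0 by simp
next
  case (Suc r)
  have Mr: "M ^\<^sub>m r \<in> carrier_mat n n" using M by simp
  have comm: "M * M ^\<^sub>m k = M ^\<^sub>m k * M" for k
  proof (induction k)
    case (Suc k)
    have "M * M ^\<^sub>m Suc k = (M * M ^\<^sub>m k) * M"
      unfolding pow_mat.simps by (rule assoc_mult_mat[symmetric]) (use M in auto)
    then show ?case using Suc by simp
  qed (use M in simp)
  have "E (Suc r) = M * ((M ^\<^sub>m r) * E 0 * (M ^\<^sub>m r)\<^sup>T) * M\<^sup>T" by (simp add: step Suc.IH)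
  also have "\<dots> = (M * M ^\<^sub>m r) * E 0 * ((M ^\<^sub>m r)\<^sup>T * M\<^sup>T)"
    by (simp add: M[THEN carrier_matD(1)] M[THEN carrier_matD(2)] Mr[THEN carrier_matD(1)]
        Mr[THEN carrier_matD(2)] E0[THEN carrier_matD(1)] E0[THEN carrier_matD(2)] mult_assoc_dims
        del: assoc_mult_mat)
  also have "(M ^\<^sub>m r)\<^sup>T * M\<^sup>T = (M * M ^\<^sub>m r)\<^sup>T"
    by (rule transpose_mult[OF M Mr, symmetric])
  finally show ?case by (simp add: comm)
qed

text \<open>
  Each step reads the diagonal block that the previous one computed, so the recursion closes up on
  the \<open>I\<^sub>2 \<times> I\<^sub>2\<close> block; the inner parenthesis is the \<open>I\<^sub>1 \<times> I\<^sub>1\<close> block after the first step.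
\<close>
lemma ibmi_block_Suc:
  fixes A G :: "real mat"
  assumes A: "A \<in> carrier_mat p p" and pd: "sym_pos_def A"
    and part: "I1 \<union> I2 = {0..<p}" "I1 \<inter> I2 = {}"
    and X: "ibmi_block A I1 I2 G r \<in> carrier_mat (card I2) (card I2)"
  defines "Bi \<equiv> mat_inv (submatrix A I1 I1)" and "Ci \<equiv> mat_inv (submatrix A I2 I2)"
    and "D \<equiv> submatrix A I1 I2" and "F \<equiv> submatrix A I2 I1"
  shows "ibmi_block A I1 I2 G (Suc r)
    = Ci + Ci * F * (Bi + Bi * D * ibmi_block A I1 I2 G r * F * Bi) * D * Ci"
proof -
  have I: "I1 \<subseteq> {0..<p}" "I2 \<subseteq> {0..<p}" using part by auto
  have part': "I2 \<union> I1 = {0..<p}" "I2 \<inter> I1 = {}" using part by auto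
  have dims: "Bi \<in> carrier_mat (card I1) (card I1)" "Ci \<in> carrier_mat (card I2) (card I2)"
    "D \<in> carrier_mat (card I1) (card I2)" "F \<in> carrier_mat (card I2) (card I1)"
    unfolding Bi_def Ci_def D_def F_def using A pd I
    by (auto intro!: sym_pos_def_mat_inv submatrix_carrier sym_pos_def_submatrix)
  have p: "dim_row A = p" using A by simp
  define X where "X = ibmi_block A I1 I2 G r"
  define W where "W = Bi + Bi * D * X * F * Bi"
  have XW: "X \<in> carrier_mat (card I2) (card I2)" "W \<in> carrier_mat (card I1) (card I1)"
    using assms(5) dims by (auto simp: X_def W_def)
  have "submatrix (ibmi_step A I1 I2 X) I1 I1 = W"
    unfolding ibmi_step_def Let_def p Bi_def[symmetric] D_def[symmetric] F_def[symmetric] W_def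
    by (rule submatrix_assemble_blocks(1)[OF part]) (use dims XW in auto)
  moreover have "submatrix (ibmi_step A I2 I1 W) I2 I2 = Ci + Ci * F * W * D * Ci"
    unfolding ibmi_step_def Let_def p Ci_def[symmetric] D_def[symmetric] F_def[symmetric]
    by (rule submatrix_assemble_blocks(1)[OF part']) (use dims XW in auto)
  ultimately show ?thesis by (simp add: Let_def X_def[symmetric] W_def)
qed

theorem theorem3p2:
  fixes p :: nat and A H G :: "real mat" and I1 I2 :: "nat set"
  assumes A_dim: "A \<in> carrier_mat p p"
    and A_spd: "sym_pos_def A"
    and H_def: "H = mat_inv A"
    and I_nonempty: "I1 \<noteq> {}" "I2 \<noteq> {}"
    and I_cover: "I1 \<union> I2 = {0..<p}"
    and I_disjoint: "I1 \<inter> I2 = {}"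
    and G_dim: "G \<in> carrier_mat (card I2) (card I2)"
  shows "(\<forall>r. mat_norm2 (ibmi_block A I1 I2 G r - submatrix H I2 I2)
              \<le> mat_norm2 (mat_inv (submatrix A I2 I2) * submatrix A I2 I1
                            * mat_inv (submatrix A I1 I1) * submatrix A I1 I2) ^ (2 * r)
                 * mat_norm2 (G - submatrix H I2 I2))
       \<and> (sym_pos_def G \<longrightarrow>
           (\<lambda>r. mat_norm2 (ibmi_block A I1 I2 G r - submatrix H I2 I2)) \<longlonglongrightarrow> 0)"
proof -
  define m n where "m = card I1" and "n = card I2"
  define B C D F where "B = submatrix A I1 I1" and "C = submatrix A I2 I2"
    and "D = submatrix A I1 I2" and "F = submatrix A I2 I1"
  define Bi Ci where "Bi = mat_inv B" and "Ci = mat_inv C"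
  define Y Z where "Y = submatrix H I2 I2" and "Z = submatrix H I1 I2"
  define S M where "S = F * Bi * D" and "M = Ci * F * Bi * D"
  have I: "I1 \<subseteq> {0..<p}" "I2 \<subseteq> {0..<p}" using I_cover by auto
  note H = sym_pos_def_mat_inv[OF A_dim A_spd, folded H_def]
  have H_pd: "sym_pos_def H" by (rule sym_pos_def_right_inverse[OF A_dim A_spd H(1,2)])
  have blocks [simp, intro]: "B \<in> carrier_mat m m" "C \<in> carrier_mat n n" "D \<in> carrier_mat m n"
    "F \<in> carrier_mat n m" "Y \<in> carrier_mat n n" "Z \<in> carrier_mat m n"
    unfolding B_def C_def D_def F_def Y_def Z_def m_def n_def
    using A_dim H(1) I by (auto intro: submatrix_carrier)
  have pd: "sym_pos_def B" "sym_pos_def C" "sym_pos_def Y"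
    unfolding B_def C_def Y_def using A_dim A_spd H(1) H_pd I by (auto intro: sym_pos_def_submatrix)
  note Bi = sym_pos_def_mat_inv[OF blocks(1) pd(1), folded Bi_def]
    and Ci = sym_pos_def_mat_inv[OF blocks(2) pd(2), folded Ci_def]
  note [simp, intro] = Bi(1) Ci(1)
  note [simp] = blocks[THEN carrier_matD(1)] blocks[THEN carrier_matD(2)]
    Bi(1)[THEN carrier_matD(1)] Bi(1)[THEN carrier_matD(2)]
    Ci(1)[THEN carrier_matD(1)] Ci(1)[THEN carrier_matD(2)]
  have Bi_pd: "sym_pos_def Bi" by (rule sym_pos_def_right_inverse[OF blocks(1) pd(1) Bi(1,2)])
  have Ci_pd: "sym_pos_def Ci" by (rule sym_pos_def_right_inverse[OF blocks(2) pd(2) Ci(1,2)])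
  have sym: "Bi\<^sup>T = Bi" "Ci\<^sup>T = Ci" "Y\<^sup>T = Y"
    using Bi_pd Ci_pd pd(3) sym_pos_def_iff Bi(1) Ci(1) blocks(5) by blast+
  have A_sym: "A\<^sup>T = A" using A_spd unfolding sym_pos_def_def by simp
  have DT: "D\<^sup>T = F" and FT: "F\<^sup>T = D"
    unfolding D_def F_def using submatrix_transpose[OF A_dim] I by (simp_all add: A_sym)
  have S_dim [simp, intro]: "S \<in> carrier_mat n n" and M_dim [simp, intro]: "M \<in> carrier_mat n n"
    by (auto simp: S_def M_def intro!: carrier_matI)

  \<comment> \<open>The second block column of \<open>A H = 1\<close>.\<close>
  have "B * Z + D * Y = submatrix (A * H) I1 I2"
    unfolding B_def Z_def D_def Y_def
    by (rule submatrix_mult[OF A_dim H(1) I_cover I_disjoint I(1,2), symmetric])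
  then have upper: "B * Z + D * Y = 0\<^sub>m m n"
    unfolding H(2) m_def n_def using submatrix_one_disjoint[OF I I_disjoint] by simp
  have "F * Z + C * Y = submatrix (A * H) I2 I2"
    unfolding F_def Z_def C_def Y_def
    by (rule submatrix_mult[OF A_dim H(1) I_cover I_disjoint I(2,2), symmetric])
  then have lower: "F * Z + C * Y = 1\<^sub>m n"
    unfolding H(2) n_def using submatrix_one[OF I(2)] by simp
  have fix_Y: "Y = Ci + M * Y"
    unfolding M_def
    by (rule block_inverse_fixpoint[of B m C n D F Bi Ci Y Z]) (use Bi Ci upper lower in auto)

  have M_eq: "M = Ci * S"
    unfolding M_def S_def
    by (simp add: mult_assoc_dims del: assoc_mult_mat)
  have "C * M = (C * Ci) * S"
    unfolding M_eq by (rule assoc_mult_mat[OF blocks(2) Ci(1) S_dim, symmetric])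
  then have CM: "C * M = S"
    unfolding Ci(2) left_mult_one_mat[OF S_dim] .
  have FB: "F * Bi \<in> carrier_mat n m" by (intro carrier_matI) simp_all
  have "S\<^sup>T = D\<^sup>T * (F * Bi)\<^sup>T" unfolding S_def by (rule transpose_mult[OF FB blocks(3)])
  also have "(F * Bi)\<^sup>T = Bi * D" using transpose_mult[OF blocks(4) Bi(1)] by (simp add: sym FT)
  also have "D\<^sup>T * (Bi * D) = S"
    unfolding S_def DT by (simp add: mult_assoc_dims del: assoc_mult_mat)
  finally have S_sym: "S\<^sup>T = S" .
  have MT: "M\<^sup>T = F * Bi * D * Ci"
    unfolding M_eq using transpose_mult[OF Ci(1) S_dim] unfolding sym S_sym by (simp only: S_def)

  note [simp] = carrier_matD[OF S_dim] carrier_matD[OF M_dim]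

  have iterate_Suc: "ibmi_block A I1 I2 G (Suc r) = Ci + M * Ci + M * X * M\<^sup>T"
    if X: "X \<in> carrier_mat n n" "X = ibmi_block A I1 I2 G r" for r X
  proof -
    define V where "V = Bi * D * X * F * Bi"
    have V: "V \<in> carrier_mat m m" unfolding V_def by (intro carrier_matI) simp_all
    have "ibmi_block A I1 I2 G (Suc r) = Ci + Ci * F * (Bi + V) * D * Ci"
      using ibmi_block_Suc[OF A_dim A_spd I_cover I_disjoint X(1)[unfolded n_def X(2)]]
      by (simp only: V_def X(2) Bi_def Ci_def B_def C_def D_def F_def)
    also have "Ci * F * (Bi + V) * D * Ci = Ci * F * Bi * D * Ci + Ci * F * V * D * Ci"
      by (simp add: carrier_matD[OF V] mult_add_dims add_mult_dims del: assoc_mult_mat)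
    also have "Ci * F * V * D * Ci = M * X * M\<^sup>T"
      unfolding V_def MT unfolding M_def
      by (simp add: mult_assoc_dims carrier_matD[OF X(1)] del: assoc_mult_mat)
    also have "Ci + (Ci * F * Bi * D * Ci + M * X * M\<^sup>T) = Ci + M * Ci + M * X * M\<^sup>T"
      unfolding M_def[symmetric] by (rule assoc_add_mat[symmetric]) (auto intro!: carrier_matI)
    finally show ?thesis .
  qed
  have iterate_dim: "ibmi_block A I1 I2 G r \<in> carrier_mat n n" for r
  proof (induction r)
    case 0
    then show ?case using G_dim by (simp add: n_def)
  next
    case (Suc r)
    show ?case unfolding iterate_Suc[OF Suc refl] by (intro carrier_matI) simp_all
  qed
  define E where "E r = ibmi_block A I1 I2 G r - Y" for r
  have step: "E (Suc r) = M * E r * M\<^sup>T" for r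
    unfolding E_def iterate_Suc[OF iterate_dim refl]
    by (rule iteration_error[OF M_dim Ci(1) iterate_dim blocks(5) sym(2,3) fix_Y])
  have E0: "E 0 = G - Y" by (simp add: E_def)
  have E0_dim: "E 0 \<in> carrier_mat n n" by (simp add: E0 minus_carrier_mat)
  have E_pow: "E r = (M ^\<^sub>m r) * E 0 * (M ^\<^sub>m r)\<^sup>T" for r
    by (rule error_power[OF M_dim E0_dim step])
  have E_norm: "mat_norm2 (E r) \<le> (mat_norm2 (M ^\<^sub>m r))\<^sup>2 * mat_norm2 (E 0)" for r
    unfolding E_pow[of r] by (rule mat_norm2_congruence_le[OF pow_carrier_mat[OF M_dim] E0_dim])

  have rate: "mat_norm2 (E r) \<le> mat_norm2 M ^ (2 * r) * mat_norm2 (E 0)" for r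
  proof -
    have "(mat_norm2 (M ^\<^sub>m r))\<^sup>2 \<le> (mat_norm2 M ^ r)\<^sup>2"
      by (rule power_mono[OF mat_norm2_pow_le[OF M_dim] mat_norm2_nonneg[OF pow_carrier_mat[OF M_dim]]])
    then have "(mat_norm2 (M ^\<^sub>m r))\<^sup>2 * mat_norm2 (E 0) \<le> (mat_norm2 M ^ r)\<^sup>2 * mat_norm2 (E 0)"
      by (rule mult_right_mono) (rule mat_norm2_nonneg[OF E0_dim])
    with E_norm[of r] show ?thesis by (simp add: power_mult[symmetric] mult.commute)
  qed

  \<comment> \<open>Multiplying the fixed-point equation by \<open>C\<close> identifies \<open>Y\<close> as the inverse of the Schur complement.\<close>
  have "C * Y = C * (Ci + M * Y)" by (rule arg_cong[OF fix_Y])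
  also have "\<dots> = C * Ci + C * (M * Y)"
    by (rule mult_add_distrib_mat) auto
  also have "C * (M * Y) = S * Y"
    unfolding CM[symmetric] by (rule assoc_mult_mat[symmetric]) auto
  finally have CY: "C * Y = 1\<^sub>m n + S * Y" by (simp add: Ci(2))
  have "(C - S) * Y = C * Y - S * Y"
    by (rule minus_mult_distrib_mat) auto
  also have "\<dots> = 1\<^sub>m n" unfolding CY by (intro eq_matI) auto
  finally have inv: "(C - S) * Y = 1\<^sub>m n" .
  have CS: "C - S \<in> carrier_mat n n" by (rule minus_carrier_mat[OF S_dim])
  have "Y * (C - S) = 1\<^sub>m n"
    by (rule mat_mult_left_right_inverse[OF CS blocks(5) inv])
  then have schur_pd: "sym_pos_def (C - S)"
    by (rule sym_pos_def_right_inverse[OF blocks(5) pd(3) CS])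
  have S_psd: "0 \<le> v \<bullet> (S *\<^sub>v v)" if v: "v \<in> carrier_vec n" for v
  proof -
    have Dv: "D *\<^sub>v v \<in> carrier_vec m" by (rule mult_mat_vec_carrier[OF blocks(3) v])
    have "S *\<^sub>v v = F *\<^sub>v (Bi *\<^sub>v (D *\<^sub>v v))"
      unfolding S_def assoc_mult_mat_vec[OF FB blocks(3) v]
      by (rule assoc_mult_mat_vec[OF blocks(4) Bi(1) Dv])
    then have "v \<bullet> (S *\<^sub>v v) = (F\<^sup>T *\<^sub>v v) \<bullet> (Bi *\<^sub>v (D *\<^sub>v v))"
      using transpose_vec_mult_scalar[OF blocks(4) _ v, of "Bi *\<^sub>v (D *\<^sub>v v)"] Dv
        mult_mat_vec_carrier[OF Bi(1) Dv] by simp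
    then show ?thesis using sym_pos_def_nonneg[OF Bi(1) Bi_pd Dv] by (simp add: FT)
  qed
  obtain q where q: "0 \<le> q" "q < 1"
    "\<And>v. v \<in> carrier_vec n \<Longrightarrow> 0 \<le> v \<bullet> (C *\<^sub>v v) \<Longrightarrow> v \<bullet> (S *\<^sub>v v) \<le> q * (v \<bullet> (C *\<^sub>v v))"
    using strictly_dominated_form[OF blocks(2) S_dim schur_pd] by blast
  have "(\<lambda>r. mat_norm2 (M ^\<^sub>m r)) \<longlonglongrightarrow> 0"
    by (rule energy_contraction_powers_tendsto_0[OF blocks(2) pd(2) M_dim q(1,2)],
        rule energy_contraction[OF blocks(2) pd(2) S_dim S_sym S_psd q(1) _ M_dim CM])
      (auto intro: q(3) sym_pos_def_nonneg[OF blocks(2) pd(2)])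
  then have "(\<lambda>r. (mat_norm2 (M ^\<^sub>m r))\<^sup>2 * mat_norm2 (E 0)) \<longlonglongrightarrow> 0\<^sup>2 * mat_norm2 (E 0)"
    by (intro tendsto_mult tendsto_power tendsto_const)
  then have lim: "(\<lambda>r. mat_norm2 (E r)) \<longlonglongrightarrow> 0"
    using tendsto_sandwich[of "\<lambda>_. 0" "\<lambda>r. mat_norm2 (E r)" sequentially
        "\<lambda>r. (mat_norm2 (M ^\<^sub>m r))\<^sup>2 * mat_norm2 (E 0)" 0]
      E_norm mat_norm2_nonneg[of "E _" n n] minus_carrier_mat[OF blocks(5)] by (auto simp: E_def)
  show ?thesis
    using rate lim unfolding E0 unfolding E_def M_def Y_def Bi_def Ci_def B_def C_def D_def F_def by simp
qed

end
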